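(* Let $\mathcal G=(\mathcal V,\mathcal E)$ be a strongly connected aperiodic graph with propagation matrix $M$, let $r$ be the maximal eigenvalue of $M$, let $v=(v_i:i\in\mathcal V)$ be the vector of limiting values, and let $V=\mathrm{diag}(v)$. Suppose the players use the limiting strategies (with any parameter $\beta\in(0,1]$) in the infinite-duration Path Guessing Game on $\mathcal G$. Then the Chooser's transition probability matrix $P=(p_{i,j})$ satisfies $$P=\frac1r\,VMV^{-1},$$ and the Guesser's fortune satisfies $$\lim_{t\to\infty}r^{t}\,E[F_t\mid X_0=i]=c\,v_i\qquad\text{for all } i\in\mathcal V,$$ where $c$ is a positive constant that depends only on $\mathcal G$ (in particular not on $i$ or $\beta$).
   Context: $\mathcal G$ is a finite strongly connected directed graph (at most one edge from $i$ to $j$; loops allowed) in which every vertex has out-degree at least $1$; $i\to j$ means there is an edge from $i$ to $j$, and $n_i$ is the out-degree of $i$. Aperiodic means that the greatest common divisor of the lengths of all directed cycles is $1$. Path Guessing Game. The players share a position $X_t\in\mathcal V$, and $F_t$ is the Guesser's fortune after $t$ steps, $F_0=1$. At node $i$ the Guesser wagers a proportion $w\in[0,1]$ of her current fortune (announced) and makes a secret random guess among the out-neighbours of $i$; the Chooser, independently of the guess, selects an out-neighbour $j$ of $i$. The fortune is multiplied by $1+(n_i-1)w$ if $n_i\ge2$ and the guess was $j$; by $1+w$ if $n_i=1$; and by $1-w$ if the guess was wrong. The players move to $j$ and play continues forever. Propagation matrix: $M=(m_{i,j})$ with $m_{i,j}=1/2$ if $n_i=1$ and $i\to j$; $m_{i,j}=1/n_i$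 if $n_i\ge2$ and $i\to j$; and $m_{i,j}=0$ otherwise. $r$ is the largest positive (Perron–Frobenius) eigenvalue of $M$. The limiting reciprocal value vector is $u=\lim_{s\to\infty}r^{-s}M^s\mathbf 1$, where $\mathbf 1$ is the all-ones vector (the limit exists and is strictly positive), and the limiting values are $v_i=u_i^{-1}$. Limiting strategies. At each visit to node $i$ the Chooser moves to $j$ with $i\to j$ with probability $p_{i,j}=1$ if $n_i=1$ and $p_{i,j}=u_j/\sum_{k:\,i\to k}u_k$ if $n_i\ge2$ ($p_{i,j}=0$ if not $i\to j$). With $p_{i,\min}=\min\{p_{i,j}:i\to j\}$ and a parameter $\beta\in(0,1]$, the Guesser at node $i$ guesses $j$ (with $i\to j$) with probability $q_{i,j}=1$ if $n_i=1$ and $q_{i,j}=(p_{i,j}-\beta p_{i,\min})/(1-n_i\beta p_{i,\min})$ if $n_i\ge2$, and wagers the proportion $w_i=1$ if $n_i=1$ and $w_i=1-n_i\beta p_{i,\min}$ if $n_i\ge2$; if $1-n_i\beta p_{i,\min}=0$, so $w_i=0$, the guessing distribution at $i$ is arbitrary. Guesses and choices at different times are made independently given the positions. *)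

theory Defs
  imports
    "HOL-Probability.Probability"
    "Graph_Theory.Pair_Digraph"
    "Graph_Theory.Digraph_Component"
begin

text \<open>
  A graph is a \<^typ>\<open>'v pair_pre_digraph\<close> over a finite type \<open>'v\<close>: arcs are pairs of vertices, so
  there are no parallel arcs, and loops are allowed.  Vectors and matrices are indexed by the type
  \<open>'v\<close>, so these definitions are meant for graphs whose vertex set is all of \<open>'v\<close>.
\<close>

definition outnbrs :: "'v pair_pre_digraph \<Rightarrow> 'v \<Rightarrow> 'v set" where
  "outnbrs G i = {j. i \<rightarrow>\<^bsub>with_proj G\<^esub> j}"

abbreviation outdeg :: "'v pair_pre_digraph \<Rightarrow> 'v \<Rightarrow> nat" where
  "outdeg G i \<equiv> out_degree (with_proj G) i"

definition aperiodic :: "'v pair_pre_digraph \<Rightarrow> bool" where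
  "aperiodic G \<longleftrightarrow> Gcd {length p | p. pre_digraph.cycle (with_proj G) p} = 1"


subsection \<open>Propagation matrix and limiting values\<close>

definition propagation_matrix :: "'v::finite pair_pre_digraph \<Rightarrow> real ^ 'v ^ 'v" where
  "propagation_matrix G = (\<chi> i j.
     if j \<in> outnbrs G i then (if outdeg G i = 1 then 1 / 2 else 1 / real (outdeg G i)) else 0)"

definition is_eigenvalue :: "real ^ 'v ^ 'v \<Rightarrow> real \<Rightarrow> bool" where
  "is_eigenvalue A x \<longleftrightarrow> (\<exists>y. y \<noteq> 0 \<and> A *v y = x *\<^sub>R y)"

definition max_eigenvalue :: "'v::finite pair_pre_digraph \<Rightarrow> real" where
  "max_eigenvalue G = Max {x. 0 < x \<and> is_eigenvalue (propagation_matrix G) x}"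

text \<open>The constant \<open>1 :: real ^ 'v\<close> is the all-ones vector.\<close>

definition reciprocal_values :: "'v::finite pair_pre_digraph \<Rightarrow> real ^ 'v" where
  "reciprocal_values G =
     lim (\<lambda>s. (1 / max_eigenvalue G ^ s) *\<^sub>R (((\<lambda>x. propagation_matrix G *v x) ^^ s) 1))"

definition limiting_values :: "'v::finite pair_pre_digraph \<Rightarrow> real ^ 'v" where
  "limiting_values G = (\<chi> i. inverse (reciprocal_values G $ i))"

definition diag_matrix :: "real ^ 'v \<Rightarrow> real ^ 'v ^ 'v" where
  "diag_matrix x = (\<chi> i j. if i = j then x $ i else 0)"


subsection \<open>Limiting strategies\<close>

definition transition_matrix :: "'v::finite pair_pre_digraph \<Rightarrow> real ^ 'v ^ 'v" where
  "transition_matrix G = (\<chi> i j.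
     if j \<in> outnbrs G i
     then (if outdeg G i = 1 then 1
           else reciprocal_values G $ j / (\<Sum>k\<in>outnbrs G i. reciprocal_values G $ k))
     else 0)"

definition chooser_strategy :: "'v::finite pair_pre_digraph \<Rightarrow> 'v \<Rightarrow> 'v pmf" where
  "chooser_strategy G i = embed_pmf (\<lambda>j. transition_matrix G $ i $ j)"

definition min_prob :: "'v::finite pair_pre_digraph \<Rightarrow> 'v \<Rightarrow> real" where
  "min_prob G i = Min {transition_matrix G $ i $ j | j. j \<in> outnbrs G i}"

definition wager :: "'v::finite pair_pre_digraph \<Rightarrow> real \<Rightarrow> 'v \<Rightarrow> real" where
  "wager G \<beta> i =
     (if outdeg G i = 1 then 1 else 1 - real (outdeg G i) * \<beta> * min_prob G i)"

text \<open>
  A relation rather than a function, because the guessing distribution is an arbitrary distribution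
  on the out-neighbours wherever the wager is zero.
\<close>

definition limiting_guess :: "'v::finite pair_pre_digraph \<Rightarrow> real \<Rightarrow> ('v \<Rightarrow> 'v pmf) \<Rightarrow> bool" where
  "limiting_guess G \<beta> q \<longleftrightarrow>
     (\<forall>i. set_pmf (q i) \<subseteq> outnbrs G i \<and>
          (wager G \<beta> i \<noteq> 0 \<longrightarrow>
            (\<forall>j\<in>outnbrs G i. pmf (q i) j =
               (if outdeg G i = 1 then 1
                else (transition_matrix G $ i $ j - \<beta> * min_prob G i) /
                     (1 - real (outdeg G i) * \<beta> * min_prob G i)))))"


subsection \<open>The Path Guessing Game\<close>

definition multiplier :: "'v pair_pre_digraph \<Rightarrow> 'v \<Rightarrow> real \<Rightarrow> 'v \<Rightarrow> 'v \<Rightarrow> real" where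
  "multiplier G i w guess j =
     (if guess = j
      then (if outdeg G i = 1 then 1 + w else 1 + (real (outdeg G i) - 1) * w)
      else 1 - w)"

text \<open>
  \<open>play G p q w i t\<close> is the joint law of position and fortune after \<open>t\<close> steps of the game started
  at \<open>i\<close>, where at node \<open>x\<close> the Chooser moves according to \<open>p x\<close> and the Guesser guesses
  according to \<open>q x\<close> and wagers the proportion \<open>w x\<close>.
  The product \<open>pair_pmf\<close> makes choice and guess independent.
\<close>

primrec play ::
  "'v pair_pre_digraph \<Rightarrow> ('v \<Rightarrow> 'v pmf) \<Rightarrow> ('v \<Rightarrow> 'v pmf) \<Rightarrow> ('v \<Rightarrow> real) \<Rightarrow> 'v \<Rightarrow> nat \<Rightarrow> ('v \<times> real) pmf"
where
  "play G p q w i 0 = return_pmf (i, 1)"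
| "play G p q w i (Suc t) =
     bind_pmf (play G p q w i t) (\<lambda>(x, f).
       map_pmf (\<lambda>(j, guess). (j, f * multiplier G x (w x) guess j)) (pair_pmf (p x) (q x)))"

definition expected_fortune ::
  "'v pair_pre_digraph \<Rightarrow> ('v \<Rightarrow> 'v pmf) \<Rightarrow> ('v \<Rightarrow> 'v pmf) \<Rightarrow> ('v \<Rightarrow> real) \<Rightarrow> 'v \<Rightarrow> nat \<Rightarrow> real"
where
  "expected_fortune G p q w i t = measure_pmf.expectation (play G p q w i t) snd"

end

theory Submission
  imports Defs
begin

text \<open>
  Aperiodicity makes \<open>M\<close> primitive, so Perron--Frobenius theory gives \<open>M u = r u\<close> and shows that
  \<open>r\<^sup>-\<^sup>s M\<^sup>s x\<close> tends to a positive multiple of \<open>u\<close> for every positive vector \<open>x\<close>. The first equation says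
  \<open>p\<^sub>i\<^sub>j = m\<^sub>i\<^sub>j u\<^sub>j / (r u\<^sub>i)\<close>.
  When the Chooser moves from \<open>i\<close> to \<open>j\<close>, the limiting Guesser multiplies her fortune on average by
  \<open>p\<^sub>i\<^sub>j / m\<^sub>i\<^sub>j\<close>, whatever \<open>\<beta>\<close> is. Hence the expected fortune is propagated by the matrix with entries
  \<open>p\<^sub>i\<^sub>j\<^sup>2 / m\<^sub>i\<^sub>j = m\<^sub>i\<^sub>j u\<^sub>j\<^sup>2 / (r\<^sup>2 u\<^sub>i\<^sup>2)\<close>, a diagonal conjugate of \<open>r\<^sup>-\<^sup>2 M\<close>, and so
  \<open>r\<^sup>t E[F\<^sub>t] = u\<^sub>i\<^sup>-\<^sup>2 r\<^sup>-\<^sup>t (M\<^sup>t u\<^sup>2)\<^sub>i\<close>, which tends to \<open>c u\<^sub>i / u\<^sub>i\<^sup>2 = c v\<^sub>i\<close>.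
\<close>

subsection \<open>Primitivity of aperiodic graphs\<close>

text \<open>The least positive difference \<open>d\<close> of two elements of
  \<open>insert 0 S\<close> divides every element, since a nonzero remainder would be a smaller
  difference. So \<open>d = 1\<close>, there are consecutive elements \<open>a\<close> and
  \<open>Suc a\<close>, and these generate every large number.\<close>

lemma nat_semigroup_cofinite:
  fixes S :: "nat set"
  assumes add: "\<And>a b. a \<in> S \<Longrightarrow> b \<in> S \<Longrightarrow> a + b \<in> S"
    and gcd: "\<And>d. (\<And>s. s \<in> S \<Longrightarrow> d dvd s) \<Longrightarrow> d = 1"
  shows "\<exists>N. \<forall>n\<ge>N. n \<in> S"
proof -
  let ?S = "insert 0 S"
  have add0: "a + b \<in> ?S" if "a \<in> ?S" "b \<in> ?S" for a b
    using that add by auto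
  have mult0: "k * a \<in> ?S" if "a \<in> ?S" for k a
  proof (induction k)
    case (Suc k)
    show ?case unfolding mult_Suc by (rule add0[OF that Suc])
  qed simp
  let ?D = "\<lambda>d. 0 < d \<and> (\<exists>a\<in>?S. a + d \<in> ?S)"
  \<comment> \<open>Were \<open>S\<close> contained in \<open>{0}\<close>, then 2 would divide all
    its elements.\<close>
  obtain s where "s \<in> S" "s \<noteq> 0"
    using gcd[of 2] by force
  then have "?D s" by auto
  define d where "d = (LEAST d. ?D d)"
  have "?D d" unfolding d_def by (rule LeastI[of ?D, OF \<open>?D s\<close>])
  then obtain a where d: "0 < d" "a \<in> ?S" "a + d \<in> ?S" by blast
  have "d dvd s" if "s \<in> S" for s
  proof (rule ccontr)
    assume nd: "\<not> d dvd s"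
    let ?q = "s div d" and ?m = "s mod d"
    \<comment> \<open>Both \<open>?q * a + s\<close> and \<open>?q * (a + d)\<close> lie in
      \<open>?S\<close>, and they differ by exactly \<open>s mod d\<close>.\<close>
    have "?q * a + s \<in> ?S" using add0 mult0[OF d(2)] that by blast
    also have "?q * a + s = ?q * (a + d) + ?m"
      using div_mult_mod_eq[of s d] by (simp only: distrib_left add.assoc)
    finally have "?D ?m"
      using mult0[OF d(3), of ?q] nd by (auto simp: mod_greater_zero_iff_not_dvd)
    then have "d \<le> ?m" unfolding d_def by (rule Least_le)
    moreover have "?m < d" using d(1) by simp
    ultimately show False by simp
  qed
  then have "d = 1" by (rule gcd)
  with d have a: "a \<in> ?S" "Suc a \<in> ?S" by auto
  \<comment> \<open>The square makes the quotient by \<open>a\<close> at least \<open>a\<close>,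
    hence larger than the remainder, so \<open>?q - ?m\<close> is a genuine difference. The extra 1
    excludes \<open>n = 0\<close>, the element that was adjoined to \<open>S\<close>.\<close>
  have "n \<in> S" if n: "a * a + 1 \<le> n" for n
  proof -
    have "n \<in> ?S"
    proof (cases "a = 0")
      case True
      then show ?thesis using mult0[OF a(2), of n] by simp
    next
      case False
      let ?q = "n div a" and ?m = "n mod a"
      have "?m < a" using False by simp
      moreover have "a \<le> ?q" using n False
        by (metis Suc_eq_plus1 Suc_leD div_le_mono nonzero_mult_div_cancel_right)
      ultimately have "(?q - ?m) * a + ?m * Suc a = ?q * a + ?m"
        by (simp add: diff_mult_distrib le_add_diff_inverse2)
      then have "n = (?q - ?m) * a + ?m * Suc a" by simp
      then show ?thesis using add0[OF mult0[OF a(1)] mult0[OF a(2)]] by metis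
    qed
    with n show ?thesis by auto
  qed
  then show ?thesis by blast
qed

lemma cas_with_proj_relpow:
  assumes "set p \<subseteq> parcs G" "pre_digraph.cas (with_proj G) u p v"
  shows "(u, v) \<in> parcs G ^^ length p"
  using assms
proof (induction p arbitrary: u)
  case Nil
  then show ?case by (simp add: pre_digraph.cas.simps)
next
  case (Cons e p)
  then show ?case
    by (cases e) (auto simp: pre_digraph.cas.simps simp del: relpow.simps intro!: relpow_Suc_I2)
qed

text \<open>The lengths of closed walks at \<open>i\<close> form an additive semigroup. A detour
  from \<open>i\<close> to a cycle and back can be made with or without going round the cycle, so a
  common divisor of these lengths divides every cycle length and is 1. For a pair \<open>i\<close>,
  \<open>j\<close>, loop at \<open>i\<close> long enough and finish with a fixed walk to
  \<open>j\<close>.\<close>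

lemma primitive_of_aperiodic:
  fixes G :: "'v::finite pair_pre_digraph"
  assumes V: "pverts G = UNIV"
    and con: "strongly_connected (with_proj G)"
    and ap: "aperiodic G"
  shows "\<exists>N. \<forall>n\<ge>N. \<forall>i j. (i, j) \<in> parcs G ^^ n"
proof -
  let ?E = "parcs G"
  have reach: "\<exists>k. (i, j) \<in> ?E ^^ k" for i j
  proof -
    have "(i, j) \<in> rtrancl_on UNIV ?E"
      using con V by (auto simp: strongly_connected_def reachable_def)
    then have "(i, j) \<in> ?E\<^sup>*"
      by (rule rtrancl_on_rtranclI)
    then show ?thesis by (simp add: rtrancl_power)
  qed
  then obtain k where k: "(i, j) \<in> ?E ^^ k i j" for i j by metis
  have trans: "(a, c) \<in> ?E ^^ (m + n)" if "(a, b) \<in> ?E ^^ m" "(b, c) \<in> ?E ^^ n" for a b c m n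
    using that by (auto simp: relpow_add)
  have closed: "\<exists>N. \<forall>n\<ge>N. n \<in> {n. (i, i) \<in> ?E ^^ n}" for i
  proof (rule nat_semigroup_cofinite)
    fix d assume d: "\<And>s. s \<in> {n. (i, i) \<in> ?E ^^ n} \<Longrightarrow> d dvd s"
    have "d dvd length p" if cyc: "pre_digraph.cycle (with_proj G) p" for p
    proof -
      from cyc obtain u where "pre_digraph.awalk (with_proj G) u p u"
        by (auto simp: pre_digraph.cycle_def)
      then have "(u, u) \<in> ?E ^^ length p"
        by (auto simp: pre_digraph.awalk_def intro: cas_with_proj_relpow)
      then have "(i, i) \<in> ?E ^^ (k i u + (length p + k u i))"
        using k trans by blast
      moreover have "(i, i) \<in> ?E ^^ (k i u + k u i)"
        using k trans by blast
      ultimately have "d dvd (k i u + (length p + k u i)) - (k i u + k u i)"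
        using d by (intro dvd_diff_nat) auto
      then show ?thesis by simp
    qed
    then have "d dvd Gcd {length p | p. pre_digraph.cycle (with_proj G) p}"
      by (intro Gcd_greatest) auto
    then show "d = 1" using ap by (simp add: aperiodic_def)
  qed (use trans in auto)
  then obtain N where N: "\<And>i n. n \<ge> N i \<Longrightarrow> (i, i) \<in> ?E ^^ n" by simp metis
  let ?N = "Max (range (\<lambda>(i, j). N i + k i j))"
  have "(i, j) \<in> ?E ^^ n" if "?N \<le> n" for n i j
  proof -
    have "N i + k i j \<le> ?N" by (rule Max_ge) auto
    with that have le: "N i + k i j \<le> n" by simp
    then have "(i, j) \<in> ?E ^^ ((n - k i j) + k i j)"
      by (intro trans[OF N k]) simp
    with le show ?thesis by simp
  qed
  then show ?thesis by blast
qed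


subsection \<open>Perron--Frobenius theory\<close>

text \<open>A nonnegative matrix with an entrywise positive power, given as an operator so that its
  powers are iterates; the image of \<open>axis j 1\<close> is column \<open>j\<close>. The exponent
  is \<open>Suc N\<close> because with exponent 0 the zero operator in dimension one would
  qualify.\<close>

locale primitive_operator =
  fixes L :: "real ^ 'n \<Rightarrow> real ^ 'n" and N :: nat
  assumes linear_L: "linear L"
    and nonneg: "\<And>x i. (\<And>j. 0 \<le> x $ j) \<Longrightarrow> 0 \<le> L x $ i"
    and primitive: "\<And>i j. 0 < (L ^^ Suc N) (axis j 1) $ i"
begin

lemma linear_pow: "linear (L ^^ n)"
proof (induction n)
  case (Suc n)
  then show ?case using linear_compose[OF Suc linear_L] by (simp add: o_def)
qed (simp add: linear_ident)

lemma nonneg_pow: "(\<And>j. 0 \<le> x $ j) \<Longrightarrow> 0 \<le> (L ^^ n) x $ i"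
proof (induction n arbitrary: i)
  case (Suc n)
  then show ?case by (simp add: nonneg)
qed simp

text \<open>Removing all of \<open>x\<close> except its \<open>j\<close>-th coordinate can only
  decrease the image of a nonnegative vector.\<close>

lemma pow_ge:
  assumes "\<And>j. 0 \<le> x $ j"
  shows "x $ j * (L ^^ n) (axis j 1) $ i \<le> (L ^^ n) x $ i"
proof -
  have "0 \<le> (L ^^ n) (x - x $ j *\<^sub>R axis j 1) $ i"
    using assms by (intro nonneg_pow) (simp add: axis_def)
  then show ?thesis
    by (simp add: linear_diff[OF linear_pow] linear_scale[OF linear_pow])
qed

text \<open>Brouwer's theorem for the normalised map \<open>L x / ?s x\<close> on the standard
  simplex gives a nonnegative eigenvector \<open>y\<close>. It is strictly positive because
  \<open>(L ^^ Suc N) y\<close>, a positive multiple of \<open>y\<close>, is.\<close>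

lemma eigenvector_exists: "\<exists>r y. 0 < r \<and> (\<forall>i. 0 < y $ i) \<and> L y = r *\<^sub>R y"
proof -
  define S where "S = {x :: real ^ 'n. (\<forall>i. 0 \<le> x $ i) \<and> (\<Sum>i\<in>UNIV. x $ i) = 1}"
  have nz: "\<exists>j. 0 < x $ j" if "x \<in> S" for x
  proof (rule ccontr)
    assume "\<nexists>j. 0 < x $ j"
    then have "(\<Sum>i\<in>UNIV. x $ i) \<le> 0" by (intro sum_nonpos) (auto simp: not_less)
    with that show False by (simp add: S_def)
  qed
  have pos: "0 < (L ^^ Suc N) x $ i" if x: "x \<in> S" for x i
  proof -
    obtain j where "0 < x $ j" using nz[OF x] by blast
    then have "0 < x $ j * (L ^^ Suc N) (axis j 1) $ i"
      using primitive by simp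
    also have "\<dots> \<le> (L ^^ Suc N) x $ i"
      using x by (intro pow_ge) (auto simp: S_def)
    finally show ?thesis .
  qed
  let ?s = "\<lambda>x. \<Sum>i\<in>UNIV. L x $ i"
  have s_pos: "0 < ?s x" if x: "x \<in> S" for x
  proof -
    have ge: "0 \<le> L x $ i" for i using x by (intro nonneg) (auto simp: S_def)
    \<comment> \<open>Otherwise the later iterate \<open>(L ^^ Suc N) x\<close>, which is positive,
      would vanish too.\<close>
    have "L x \<noteq> 0"
    proof
      assume "L x = 0"
      then have "(L ^^ Suc N) x = 0"
        by (simp only: funpow_Suc_right o_apply linear_0[OF linear_pow])
      with pos[OF x, of undefined] show False by simp
    qed
    then obtain i where "L x $ i \<noteq> 0" by (auto simp: vec_eq_iff)
    with ge have "0 < L x $ i" by (simp add: less_le)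
    then show ?thesis using ge by (intro sum_pos2[of _ i]) auto
  qed
  have "compact S"
  proof (rule compact_eq_bounded_closed[THEN iffD2], intro conjI)
    have "norm x \<le> 1" if "x \<in> S" for x
    proof -
      have "norm x \<le> (\<Sum>i\<in>UNIV. \<bar>x $ i\<bar>)" by (rule norm_le_l1_cart)
      also have "\<dots> = 1" using that by (simp add: S_def)
      finally show ?thesis .
    qed
    then show "bounded S" by (auto simp: bounded_iff)
    show "closed S" unfolding S_def
      by (intro closed_Collect_conj closed_Collect_all closed_Collect_le closed_Collect_eq continuous_intros)
  qed
  moreover have "convex S"
    by (auto simp: convex_def S_def sum.distrib simp flip: sum_distrib_left)
  moreover have "axis undefined 1 \<in> S"
    by (auto simp: S_def axis_def)
  then have "S \<noteq> {}" by blast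
  moreover have "continuous_on S (\<lambda>x. (1 / ?s x) *\<^sub>R L x)"
    using s_pos by (intro continuous_intros linear_continuous_on_compose[OF continuous_on_id linear_L]) force
  moreover have "(\<lambda>x. (1 / ?s x) *\<^sub>R L x) \<in> S \<rightarrow> S"
  proof
    fix x assume x: "x \<in> S"
    then have "0 \<le> L x $ i" for i by (intro nonneg) (auto simp: S_def)
    then show "(1 / ?s x) *\<^sub>R L x \<in> S"
      using s_pos[OF x] by (simp add: S_def flip: sum_divide_distrib)
  qed
  ultimately obtain y where y: "y \<in> S" "(1 / ?s y) *\<^sub>R L y = y"
    by (rule brouwer)
  define r where "r = ?s y"
  have r: "0 < r" unfolding r_def by (rule s_pos[OF y(1)])
  have Ly: "L y = r *\<^sub>R y"
    using r arg_cong[OF y(2), of "scaleR r"] unfolding r_def[symmetric] by simp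
  have pow: "(L ^^ n) y = r ^ n *\<^sub>R y" for n
    by (induction n) (simp_all add: linear_scale[OF linear_L] Ly)
  have "0 < y $ i" for i
  proof -
    have "0 < r ^ Suc N * y $ i"
      using pos[OF y(1), of i] unfolding pow by (simp del: power.simps)
    then show ?thesis using r zero_less_mult_pos zero_less_power by blast
  qed
  with r Ly show ?thesis by blast
qed

end

text \<open>Ratios to the fixed vector \<open>y\<close> replace coordinates: \<open>L\<close> then behaves like a stochastic
  matrix, whose iterates cannot increase the largest or decrease the smallest ratio.\<close>

locale primitive_fixed_vector = primitive_operator +
  fixes y
  assumes y_pos: "0 < y $ i" and fixed: "L y = y"
begin

definition lo where "lo x = Min (range (\<lambda>i. x $ i / y $ i))"
definition hi where "hi x = Max (range (\<lambda>i. x $ i / y $ i))"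

lemma lo_le: "lo x * y $ i \<le> x $ i"
  using y_pos[of i] unfolding lo_def by (subst pos_le_divide_eq[symmetric]) auto

lemma le_hi: "x $ i \<le> hi x * y $ i"
  using y_pos[of i] unfolding hi_def by (subst pos_divide_le_eq[symmetric]) auto

lemma lo_attained: "\<exists>i. x $ i = lo x * y $ i"
proof -
  have "lo x \<in> range (\<lambda>i. x $ i / y $ i)" unfolding lo_def by (rule Min_in) auto
  then obtain i where "lo x = x $ i / y $ i" by blast
  then have "x $ i = lo x * y $ i" using y_pos[of i] by (simp add: less_imp_neq[symmetric])
  then show ?thesis by blast
qed

lemma hi_attained: "\<exists>i. x $ i = hi x * y $ i"
proof -
  have "hi x \<in> range (\<lambda>i. x $ i / y $ i)" unfolding hi_def by (rule Max_in) auto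
  then obtain i where "hi x = x $ i / y $ i" by blast
  then have "x $ i = hi x * y $ i" using y_pos[of i] by (simp add: less_imp_neq[symmetric])
  then show ?thesis by blast
qed

lemma lo_geI: "(\<And>i. c * y $ i \<le> x $ i) \<Longrightarrow> c \<le> lo x"
  using lo_attained[of x] mult_le_cancel_right_pos[OF y_pos] by metis

lemma hi_leI: "(\<And>i. x $ i \<le> c * y $ i) \<Longrightarrow> hi x \<le> c"
  using hi_attained[of x] mult_le_cancel_right_pos[OF y_pos] by metis

lemma lo_le_hi: "lo x \<le> hi x"
proof -
  obtain i where "x $ i = lo x * y $ i" using lo_attained by blast
  then have "lo x * y $ i \<le> hi x * y $ i" using le_hi[of x i] by simp
  then show ?thesis using y_pos[of i] by simp
qed

lemma fixed_pow: "(L ^^ n) y = y"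
  by (induction n) (simp_all add: fixed)

lemma lo_mono: "lo x \<le> lo (L x)"
proof (rule lo_geI)
  fix i
  have "0 \<le> L (x - lo x *\<^sub>R y) $ i" by (rule nonneg) (simp add: lo_le)
  then show "lo x * y $ i \<le> L x $ i"
    by (simp add: linear_diff[OF linear_L] linear_scale[OF linear_L] fixed)
qed

lemma hi_mono: "hi (L x) \<le> hi x"
proof (rule hi_leI)
  fix i
  have "0 \<le> L (hi x *\<^sub>R y - x) $ i" by (rule nonneg) (simp add: le_hi)
  then show "L x $ i \<le> hi x * y $ i"
    by (simp add: linear_diff[OF linear_L] linear_scale[OF linear_L] fixed)
qed

text \<open>The vector \<open>x - lo x *\<^sub>R y\<close> is nonnegative and equals
  \<open>(hi x - lo x) * y $ j\<close> at a coordinate \<open>j\<close> of largest ratio. After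
  \<open>Suc N\<close> steps this excess reaches every coordinate, so the smallest ratio rises by a
  fixed fraction of the gap.\<close>

lemma lo_contraction: "\<exists>\<delta>>0. \<forall>x. lo x + \<delta> * (hi x - lo x) \<le> lo ((L ^^ Suc N) x)"
proof -
  \<comment> \<open>These are the entries of the stochastic matrix obtained from
    \<open>L ^^ Suc N\<close> by conjugating with the diagonal of \<open>y\<close>; \<delta> is the
    smallest of them.\<close>
  define f where "f = (\<lambda>(i, j). y $ j * (L ^^ Suc N) (axis j 1) $ i / y $ i)"
  define \<delta> where "\<delta> = Min (range f)"
  have "0 < f z" for z
    using primitive y_pos by (cases z) (simp add: f_def del: funpow.simps)
  then have "0 < \<delta>" unfolding \<delta>_def by (subst Min_gr_iff) auto
  moreover have "lo x + \<delta> * (hi x - lo x) \<le> lo ((L ^^ Suc N) x)" for x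
  proof (rule lo_geI)
    fix i
    obtain j where j: "x $ j = hi x * y $ j" using hi_attained by blast
    have "\<delta> \<le> f (i, j)" unfolding \<delta>_def by (rule Min_le) auto
    then have "\<delta> * y $ i \<le> y $ j * (L ^^ Suc N) (axis j 1) $ i"
      using y_pos[of i] by (simp add: f_def pos_le_divide_eq del: funpow.simps)
    then have "(hi x - lo x) * (\<delta> * y $ i) \<le> (hi x - lo x) * (y $ j * (L ^^ Suc N) (axis j 1) $ i)"
      using lo_le_hi by (intro mult_left_mono) (auto simp: algebra_simps)
    also have "\<dots> = (x - lo x *\<^sub>R y) $ j * (L ^^ Suc N) (axis j 1) $ i"
      by (simp add: j algebra_simps del: funpow.simps)
    also have "\<dots> \<le> (L ^^ Suc N) (x - lo x *\<^sub>R y) $ i"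
      by (rule pow_ge) (simp add: lo_le)
    also have "\<dots> = (L ^^ Suc N) x $ i - lo x * y $ i"
      by (simp add: linear_diff[OF linear_pow] linear_scale[OF linear_pow] fixed_pow del: funpow.simps)
    finally show "(lo x + \<delta> * (hi x - lo x)) * y $ i \<le> (L ^^ Suc N) x $ i"
      by (simp add: algebra_simps del: funpow.simps)
  qed
  ultimately show ?thesis by blast
qed

text \<open>The extreme ratios converge monotonically to some \<open>A\<close> and \<open>B\<close>,
  and the contraction passes to the limit as \<open>A + \<delta> * (B - A) \<le> A\<close>, which
  forces \<open>A = B\<close>. The bound \<open>c \<ge> lo x\<close> makes the limit positive for
  positive \<open>x\<close>.\<close>

theorem iterates_converge:
  "\<exists>c\<ge>lo x. (\<lambda>s. (L ^^ s) x) \<longlonglongrightarrow> c *\<^sub>R y"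
proof -
  let ?a = "\<lambda>s. lo ((L ^^ s) x)" and ?b = "\<lambda>s. hi ((L ^^ s) x)"
  have inc: "incseq ?a" and dec: "decseq ?b"
    by (auto intro!: incseq_SucI decseq_SucI lo_mono hi_mono)
  have ab: "?a 0 \<le> ?a s" "?a s \<le> ?b s" "?b s \<le> ?b 0" for s
    using incseqD[OF inc, of 0 s] decseqD[OF dec, of 0 s] lo_le_hi by auto
  obtain A where A: "?a \<longlonglongrightarrow> A" "\<And>s. ?a s \<le> A"
    using incseq_convergent[OF inc, of "?b 0"] order_trans[OF ab(2,3)] by blast
  obtain B where B: "?b \<longlonglongrightarrow> B"
    using decseq_convergent[OF dec, of "?a 0"] order_trans[OF ab(1,2)] by blast
  obtain \<delta> where \<delta>: "0 < \<delta>" "\<And>x. lo x + \<delta> * (hi x - lo x) \<le> lo ((L ^^ Suc N) x)"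
    using lo_contraction by blast
  have step: "?a s + \<delta> * (?b s - ?a s) \<le> ?a (s + Suc N)" for s
    using \<delta>(2)[of "(L ^^ s) x"] by (simp only: add.commute[of s] funpow_add o_apply)
  have "(\<lambda>s. ?a s + \<delta> * (?b s - ?a s)) \<longlonglongrightarrow> A + \<delta> * (B - A)"
    by (intro tendsto_intros A B)
  moreover have "(\<lambda>s. ?a (s + Suc N)) \<longlonglongrightarrow> A"
    by (rule LIMSEQ_ignore_initial_segment[OF A(1)])
  ultimately have "A + \<delta> * (B - A) \<le> A"
    by (rule LIMSEQ_le) (use step in blast)
  then have "B \<le> A" using \<delta>(1) by (simp add: mult_le_0_iff)
  moreover have "A \<le> B" using A(1) B ab by (intro LIMSEQ_le) auto
  ultimately have "A = B" by simp
  have "(\<lambda>s. (L ^^ s) x) \<longlonglongrightarrow> A *\<^sub>R y"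
  proof (rule vec_tendstoI)
    fix i
    have "(\<lambda>s. (L ^^ s) x $ i) \<longlonglongrightarrow> A * y $ i"
      by (rule tendsto_sandwich[of "\<lambda>s. ?a s * y $ i" _ _ "\<lambda>s. ?b s * y $ i"])
         (use A(1) B \<open>A = B\<close> in \<open>auto intro!: tendsto_intros simp: lo_le le_hi\<close>)
    then show "(\<lambda>s. (L ^^ s) x $ i) \<longlonglongrightarrow> (A *\<^sub>R y) $ i" by simp
  qed
  with A(2)[of 0] show ?thesis by auto
qed

text \<open>If \<open>z\<close> has a positive coordinate, then \<open>L z\<close> cannot exceed
  \<open>z\<close> where the ratio to \<open>y\<close> is largest, and \<open>z\<close> is positive
  there. Otherwise the same applies to \<open>- z\<close>.\<close>

lemma eigenvalue_le_1:
  assumes "L z = \<mu> *\<^sub>R z" "z \<noteq> 0"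
  shows "\<mu> \<le> 1"
proof -
  have *: "\<mu> \<le> 1" if z: "L z = \<mu> *\<^sub>R z" and k: "0 < z $ k" for z k
  proof -
    obtain i where i: "z $ i = hi z * y $ i" using hi_attained by blast
    have "0 < hi z * y $ k" using k le_hi[of z k] by simp
    then have "0 < hi z" using y_pos[of k] by (simp add: zero_less_mult_iff)
    then have "0 < z $ i" using i y_pos by simp
    moreover have "\<mu> * z $ i \<le> z $ i"
    proof -
      have "\<mu> * z $ i = L z $ i" by (simp add: z)
      also have "\<dots> \<le> hi (L z) * y $ i" by (rule le_hi)
      also have "\<dots> \<le> hi z * y $ i" using hi_mono y_pos[of i] by (simp add: mult_right_mono)
      finally show ?thesis using i by simp
    qed
    ultimately show ?thesis by simp
  qed
  obtain k where "z $ k \<noteq> 0" using assms(2) by (auto simp: vec_eq_iff)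
  then consider "0 < z $ k" | "0 < (- z) $ k" by fastforce
  then show ?thesis
    using *[OF assms(1)] *[of "- z" k] assms(1) by cases (auto simp: linear_neg[OF linear_L])
qed

end

text \<open>Needed because \<open>max_eigenvalue\<close> is a \<open>Max\<close>. The eigenvalues
  are the roots of the characteristic polynomial, and a single non-eigenvalue \<open>c\<close> shows
  that this polynomial is nonzero, without computing its degree.\<close>

lemma finite_eigenvalues:
  fixes A :: "real ^ 'n ^ 'n"
  assumes "\<not> is_eigenvalue A c"
  shows "finite {x. is_eigenvalue A x}"
proof -
  define p where "p = det (\<chi> i j. [:A $ i $ j:] - (if i = j then [:0, 1:] else (0 :: real poly)))"
  have poly_p: "poly p x = det (A - mat x)" for x
    by (simp add: p_def det_def poly_sum poly_prod of_int_poly mat_def if_distrib[of "\<lambda>q. poly q x"] cong: if_cong)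
  have iff: "is_eigenvalue A x \<longleftrightarrow> poly p x = 0" for x
  proof -
    have mx: "mat x *v y = x *\<^sub>R y" for y :: "real ^ 'n"
      by (simp add: vec_eq_iff matrix_vector_mult_def mat_def if_distrib[of "\<lambda>a. a * _"] cong: if_cong)
    have "poly p x \<noteq> 0 \<longleftrightarrow> (\<exists>B. B ** (A - mat x) = mat 1)"
      by (simp add: poly_p flip: invertible_det_nz invertible_left_inverse)
    also have "\<dots> \<longleftrightarrow> \<not> is_eigenvalue A x"
      by (auto simp: matrix_left_invertible_ker is_eigenvalue_def matrix_vector_mult_diff_rdistrib mx)
    finally show ?thesis by blast
  qed
  from assms have "p \<noteq> 0" by (auto simp: iff)
  then show ?thesis by (simp add: iff poly_roots_finite)
qed


subsection \<open>The game with limiting strategies\<close>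

lemma pmf_embed_pmf_finite:
  fixes f :: "'a::finite \<Rightarrow> real"
  assumes "\<And>x. 0 \<le> f x" "(\<Sum>x\<in>UNIV. f x) = 1"
  shows "pmf (embed_pmf f) x = f x"
proof (rule pmf_embed_pmf)
  show "(\<integral>\<^sup>+x. ennreal (f x) \<partial>count_space UNIV) = 1"
    using assms by (simp add: nn_integral_count_space_finite sum_ennreal)
qed (fact assms(1))

lemma diag_matrix_mult: "(diag_matrix x ** A) $ i $ j = x $ i * A $ i $ j"
  by (simp add: matrix_matrix_mult_def diag_matrix_def if_distrib[of "\<lambda>a. a * _"] cong: if_cong)

lemma mult_diag_matrix: "(A ** diag_matrix x) $ i $ j = A $ i $ j * x $ j"
  by (simp add: matrix_matrix_mult_def diag_matrix_def if_distrib[of "\<lambda>a. _ * a"] cong: if_cong)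

lemma matrix_inv_diag_matrix:
  assumes "\<And>i. x $ i \<noteq> 0"
  shows "matrix_inv (diag_matrix x) = diag_matrix (\<chi> i. inverse (x $ i))"
    (is "_ = ?B")
proof -
  let ?A = "diag_matrix x"
  have AB: "?A ** ?B = mat 1" and BA: "?B ** ?A = mat 1"
    using assms unfolding vec_eq_iff diag_matrix_mult by (simp_all add: diag_matrix_def mat_def)
  \<comment> \<open>\<open>matrix_inv\<close> is a choice; \<open>?B\<close> witnesses that the
    chosen matrix is an inverse, and uniqueness then identifies the two.\<close>
  then have "matrix_inv ?A ** ?A = mat 1"
    unfolding matrix_inv_def by (rule_tac someI2[of _ ?B]) auto
  then have "matrix_inv ?A ** ?A ** ?B = ?B" by (simp add: matrix_mul_lid)
  then show ?thesis by (simp add: matrix_mul_rid AB flip: matrix_mul_assoc)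
qed

locale aperiodic_game =
  fixes G :: "'v::finite pair_pre_digraph"
  assumes pverts: "pverts G = UNIV"
    and outdeg_ge_1: "1 \<le> outdeg G i"
    and connected: "strongly_connected (with_proj G)"
    and aperiodic: "aperiodic G"
begin

abbreviation "M \<equiv> propagation_matrix G"
abbreviation "r \<equiv> max_eigenvalue G"
abbreviation "u \<equiv> reciprocal_values G"
abbreviation "T \<equiv> transition_matrix G"

lemma outdeg_eq_card: "outdeg G i = card (outnbrs G i)"
proof -
  have "out_arcs (with_proj G) i = Pair i ` outnbrs G i"
    by (auto simp: out_arcs_def outnbrs_def)
  then show ?thesis by (simp add: out_degree_def card_image inj_on_def)
qed

section \<open>The propagation matrix: powers, Perron data and the Chooser's transition
  probabilities\<close>

lemma M_nonneg: "0 \<le> M $ i $ j"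
  by (simp add: propagation_matrix_def)

lemma M_pos_iff: "0 < M $ i $ j \<longleftrightarrow> j \<in> outnbrs G i"
  using outdeg_ge_1[of i] by (simp add: propagation_matrix_def)

lemma M_vec: "(M *v x) $ i = (\<Sum>j\<in>outnbrs G i. M $ i $ j * x $ j)"
  unfolding matrix_vector_mult_def
  by (simp, rule sum.mono_neutral_right) (auto simp: propagation_matrix_def)

lemma M_vec_nonneg: "(\<And>j. 0 \<le> x $ j) \<Longrightarrow> 0 \<le> (M *v x) $ i"
  by (simp add: M_vec sum_nonneg M_nonneg)

lemma M_pow_nonneg: "(\<And>j. 0 \<le> x $ j) \<Longrightarrow> 0 \<le> (((*v) M ^^ n) x) $ i"
proof (induction n arbitrary: i)
  case (Suc n)
  then show ?case by (simp add: M_vec_nonneg)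
qed simp

lemma M_pow_pos: "(i, j) \<in> parcs G ^^ n \<Longrightarrow> 0 < (((*v) M ^^ n) (axis j 1)) $ i"
proof (induction n arbitrary: i)
  case (Suc n)
  let ?z = "((*v) M ^^ n) (axis j 1)"
  from Suc.prems obtain k where k: "(i, k) \<in> parcs G" "(k, j) \<in> parcs G ^^ n"
    by (meson relpow_Suc_D2)
  then have ik: "k \<in> outnbrs G i" by (simp add: outnbrs_def)
  have "0 < M $ i $ k * ?z $ k"
    using ik Suc.IH[OF k(2)] by (simp add: M_pos_iff)
  also have "\<dots> \<le> (M *v ?z) $ i"
    unfolding M_vec using ik
    by (intro member_le_sum) (auto intro!: mult_nonneg_nonneg M_nonneg M_pow_nonneg simp: axis_def)
  finally show ?case by simp
qed (simp add: axis_def)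

text \<open>Divide \<open>M\<close> by the eigenvalue \<rho> of a positive eigenvector
  \<open>y\<close>: the result \<open>K\<close> fixes \<open>y\<close>. Its real eigenvalues are at
  most 1, so \<rho> is the maximal eigenvalue \<open>r\<close>; its iterates on the all-ones vector
  converge to a positive multiple of \<open>y\<close>, and that multiple is
  \<open>u\<close>.\<close>

lemma perron:
  shows r_pos: "0 < r"
    and u_pos: "\<And>i. 0 < u $ i"
    and M_u: "M *v u = r *\<^sub>R u"
    and M_pow_limit: "\<And>x. (\<And>i. 0 < x $ i) \<Longrightarrow>
      \<exists>c>0. (\<lambda>s. (1 / r ^ s) *\<^sub>R ((*v) M ^^ s) x) \<longlonglongrightarrow> c *\<^sub>R u"
proof -
  obtain N where "\<And>n i j. n \<ge> N \<Longrightarrow> (i, j) \<in> parcs G ^^ n"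
    using primitive_of_aperiodic[OF pverts connected aperiodic] by blast
  then have prim: "0 < (((*v) M ^^ Suc N) (axis j 1)) $ i" for i j
    by (intro M_pow_pos) (auto simp del: relpow.simps)
  interpret primitive_operator "(*v) M" N
    by (rule primitive_operator.intro) (fact matrix_vector_mul_linear M_vec_nonneg prim)+
  obtain \<rho> y where \<rho>: "0 < \<rho>" and y: "\<And>i. 0 < y $ i" "M *v y = \<rho> *\<^sub>R y"
    using eigenvector_exists by blast
  define K where "K = (\<lambda>x. (1 / \<rho>) *\<^sub>R (M *v x))"
  have K_pow: "(K ^^ n) x = (1 / \<rho> ^ n) *\<^sub>R ((*v) M ^^ n) x" for n x
    by (induction n) (simp_all add: K_def linear_scale[OF linear_L] mult.commute)
  interpret K: primitive_fixed_vector K N y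
  proof (intro primitive_fixed_vector.intro primitive_operator.intro primitive_fixed_vector_axioms.intro)
    show "linear K"
      unfolding K_def by (intro linear_compose_scale_right linear_L)
    show "0 \<le> K x $ i" if "\<And>j. 0 \<le> x $ j" for x i
      using M_vec_nonneg[OF that] \<rho> by (simp add: K_def)
    show "0 < (K ^^ Suc N) (axis j 1) $ i" for i j
      unfolding K_pow using prim[of j i] \<rho> by (simp del: funpow.simps power.simps)
    show "K y = y" using \<rho> y(2) by (simp add: K_def)
  qed (fact y(1))
  have y0: "y \<noteq> 0" using y(1)[of undefined] by auto
  have le: "x \<le> \<rho>" if ev: "is_eigenvalue M x" for x
  proof -
    obtain z where z: "z \<noteq> 0" "M *v z = x *\<^sub>R z"
      using ev by (auto simp: is_eigenvalue_def)
    then have "K z = (x / \<rho>) *\<^sub>R z" by (simp add: K_def)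
    then have "x / \<rho> \<le> 1" using z(1) by (rule K.eigenvalue_le_1)
    then show ?thesis using \<rho> by simp
  qed
  \<comment> \<open>Since \<rho> bounds all eigenvalues, \<open>\<rho> + 1\<close> is not
    one.\<close>
  then have "finite {x. is_eigenvalue M x}"
    by (intro finite_eigenvalues[of _ "\<rho> + 1"]) (force dest: le)
  then have fin: "finite {x. 0 < x \<and> is_eigenvalue M x}"
    by (rule rev_finite_subset) auto
  have r: "r = \<rho>"
    unfolding max_eigenvalue_def
  proof (rule Max_eqI[OF fin])
    show "x \<le> \<rho>" if "x \<in> {x. 0 < x \<and> is_eigenvalue M x}" for x
      using that le by blast
    show "\<rho> \<in> {x. 0 < x \<and> is_eigenvalue M x}"
      using \<rho> y(2) y0 by (auto simp: is_eigenvalue_def)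
  qed
  have conv: "\<exists>c>0. (\<lambda>s. (1 / r ^ s) *\<^sub>R ((*v) M ^^ s) x) \<longlonglongrightarrow> c *\<^sub>R y"
    if x: "\<And>i. 0 < x $ i" for x
  proof -
    obtain i where "x $ i = K.lo x * y $ i" using K.lo_attained by blast
    then have "0 < K.lo x" using x[of i] y(1)[of i] by (simp add: zero_less_mult_iff)
    moreover obtain c where "K.lo x \<le> c" "(\<lambda>s. (K ^^ s) x) \<longlonglongrightarrow> c *\<^sub>R y"
      using K.iterates_converge by blast
    ultimately show ?thesis unfolding r K_pow by (intro exI[of _ c]) auto
  qed
  obtain c where c: "0 < c" "(\<lambda>s. (1 / r ^ s) *\<^sub>R ((*v) M ^^ s) 1) \<longlonglongrightarrow> c *\<^sub>R y"
    using conv[of 1] by auto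
  have u: "u = c *\<^sub>R y"
    unfolding reciprocal_values_def by (rule limI[OF c(2)])
  show "0 < r" using r \<rho> by simp
  show "0 < u $ i" for i using u c(1) y(1) by simp
  show "M *v u = r *\<^sub>R u" by (simp add: u linear_scale[OF linear_L] y(2) r mult.commute)
  show "\<exists>c>0. (\<lambda>s. (1 / r ^ s) *\<^sub>R ((*v) M ^^ s) x) \<longlonglongrightarrow> c *\<^sub>R u"
    if "\<And>i. 0 < x $ i" for x
  proof -
    obtain d where "0 < d" "(\<lambda>s. (1 / r ^ s) *\<^sub>R ((*v) M ^^ s) x) \<longlonglongrightarrow> d *\<^sub>R y"
      using conv[OF \<open>\<And>i. 0 < x $ i\<close>] by blast
    then show ?thesis using c(1) u by (intro exI[of _ "d / c"]) auto
  qed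
qed

text \<open>Row \<open>i\<close> of \<open>M u = r u\<close> evaluates the normalising sum. With
  several out-neighbours the entries of the row equal \<open>1 / n\<close>, so the sum of
  \<open>u\<close> over them is \<open>n * r * u $ i\<close>; with one out-neighbour
  \<open>j\<close> the row reads \<open>u $ j / 2 = r * u $ i\<close>, and both sides are 1.\<close>

lemma T_eq: "T $ i $ j = M $ i $ j * u $ j / (r * u $ i)"
proof -
  have ru: "r * u $ i = (\<Sum>k\<in>outnbrs G i. M $ i $ k * u $ k)"
    using arg_cong[OF M_u, of "\<lambda>x. x $ i"] by (simp add: M_vec)
  have "0 < r * u $ i" using r_pos u_pos by simp
  show ?thesis
  proof (cases "j \<in> outnbrs G i")
    case False
    then show ?thesis by (simp add: transition_matrix_def propagation_matrix_def)
  next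
    case j: True
    show ?thesis
    proof (cases "outdeg G i = 1")
      case True
      then have "outnbrs G i = {j}"
        using j by (auto simp: outdeg_eq_card card_1_singleton_iff)
      then show ?thesis
        using ru u_pos[of j] u_pos[of i] r_pos True by (simp add: transition_matrix_def propagation_matrix_def)
    next
      case False
      have "r * u $ i = (\<Sum>k\<in>outnbrs G i. u $ k) / outdeg G i"
        unfolding ru using False by (simp add: propagation_matrix_def sum_divide_distrib)
      then show ?thesis
        using j False outdeg_ge_1[of i] by (simp add: transition_matrix_def propagation_matrix_def)
    qed
  qed
qed

lemma T_nonneg: "0 \<le> T $ i $ j"
  unfolding T_eq using r_pos u_pos by (simp add: M_nonneg less_imp_le)

lemma sum_T: "(\<Sum>j\<in>outnbrs G i. T $ i $ j) = 1"
proof -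
  have "(\<Sum>j\<in>outnbrs G i. T $ i $ j) = (M *v u) $ i / (r * u $ i)"
    by (simp add: T_eq M_vec sum_divide_distrib)
  also have "\<dots> = 1" using r_pos u_pos[of i] by (simp add: M_u)
  finally show ?thesis .
qed

lemma T_outside: "j \<notin> outnbrs G i \<Longrightarrow> T $ i $ j = 0"
  by (simp add: transition_matrix_def)

lemma pmf_chooser_strategy: "pmf (chooser_strategy G i) j = T $ i $ j"
  unfolding chooser_strategy_def
proof (rule pmf_embed_pmf_finite)
  show "(\<Sum>j\<in>UNIV. T $ i $ j) = 1"
    unfolding sum_T[of i, symmetric] by (rule sum.mono_neutral_right) (auto simp: T_outside)
qed (rule T_nonneg)

theorem transition_matrix_eq:
  "T = (1 / r) *\<^sub>R (diag_matrix (limiting_values G) ** M ** matrix_inv (diag_matrix (limiting_values G)))"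
proof -
  have "matrix_inv (diag_matrix (limiting_values G)) = diag_matrix u"
    using u_pos by (subst matrix_inv_diag_matrix)
      (auto simp: limiting_values_def less_imp_neq[symmetric] vec_lambda_eta)
  then have "T $ i $ j = ((1 / r) *\<^sub>R (diag_matrix (limiting_values G) ** M **
      matrix_inv (diag_matrix (limiting_values G)))) $ i $ j" for i j
    by (simp only: vector_scaleR_component mult_diag_matrix diag_matrix_mult T_eq)
       (simp add: limiting_values_def field_simps)
  then show ?thesis unfolding vec_eq_iff by blast
qed

section \<open>The Guesser's expected multiplier\<close>

lemma min_prob_le: "j \<in> outnbrs G i \<Longrightarrow> min_prob G i \<le> T $ i $ j"
  unfolding min_prob_def by (rule Min_le) auto

text \<open>This covers nodes where the guess is arbitrary. A zero wager means
  \<open>n * \<beta> * p_min = 1\<close>, so \<open>p_min\<close> is at least \<open>1 / n\<close>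
  as \<open>\<beta> \<le> 1\<close>; then \<open>n\<close> probabilities with sum 1 are all at least
  \<open>1 / n\<close>, hence equal to it.\<close>

lemma wager_0_imp_uniform:
  assumes w: "wager G \<beta> i = 0" and "0 < \<beta>" "\<beta> \<le> 1" and j: "j \<in> outnbrs G i"
  shows "outdeg G i * T $ i $ j = 1"
proof -
  let ?n = "real (outdeg G i)" and ?m = "min_prob G i"
  have n: "0 < ?n" using outdeg_ge_1[of i] by simp
  have nm: "?n * \<beta> * ?m = 1" using w by (simp add: wager_def split: if_splits)
  have "0 < ?m" using nm n \<open>0 < \<beta>\<close> by (metis zero_less_mult_pos mult_pos_pos zero_less_one)
  then have "?n * \<beta> * ?m \<le> ?n * 1 * ?m"
    using \<open>\<beta> \<le> 1\<close> n by (intro mult_right_mono mult_left_mono) auto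
  then have m: "1 / ?n \<le> ?m" using nm n by (simp add: field_simps)
  have ge: "0 \<le> T $ i $ k - 1 / ?n" if "k \<in> outnbrs G i" for k
    using min_prob_le[OF that] m by simp
  have "(\<Sum>k\<in>outnbrs G i. T $ i $ k - 1 / ?n) = 0"
    using n by (simp add: sum_subtractf sum_T flip: outdeg_eq_card)
  then have "T $ i $ j - 1 / ?n = 0"
    using ge j by (subst (asm) sum_nonneg_eq_0_iff) auto
  then show ?thesis using n by simp
qed

text \<open>For \<open>n \<ge> 2\<close> the average over the guess is
  \<open>(1 - w) + n * w * q_j\<close>. Here \<open>1 - w = n * \<beta> * p_min\<close> and
  \<open>w * q_j = p_j - \<beta> * p_min\<close>, so \<beta> cancels and \<open>n * p_j\<close>
  remains. For \<open>n = 1\<close> the fortune doubles while the entry of \<open>M\<close> is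
  \<open>1 / 2\<close>.\<close>

lemma expected_multiplier:
  assumes q: "limiting_guess G \<beta> q" and \<beta>: "0 < \<beta>" "\<beta> \<le> 1" and j: "j \<in> outnbrs G i"
  shows "M $ i $ j * (\<Sum>g\<in>UNIV. pmf (q i) g * multiplier G i (wager G \<beta> i) g j) = T $ i $ j"
proof -
  let ?n = "real (outdeg G i)" and ?w = "wager G \<beta> i" and ?m = "min_prob G i"
  have n: "0 < ?n" using outdeg_ge_1[of i] by simp
  define b where "b = (if outdeg G i = 1 then 1 + ?w else 1 + (?n - 1) * ?w)"
  \<comment> \<open>Every guess receives the losing factor \<open>1 - ?w\<close>; the right guess
    receives the excess of the winning factor \<open>b\<close> on top.\<close>
  have "(\<Sum>g\<in>UNIV. pmf (q i) g * multiplier G i ?w g j) =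
      (\<Sum>g\<in>UNIV. (1 - ?w) * pmf (q i) g + (if g = j then pmf (q i) j * (b - (1 - ?w)) else 0))"
    by (rule sum.cong) (auto simp: multiplier_def b_def algebra_simps)
  also have "\<dots> = (1 - ?w) + pmf (q i) j * (b - (1 - ?w))"
    by (simp add: sum.distrib sum_pmf_eq_1 flip: sum_distrib_left)
  finally have E: "(\<Sum>g\<in>UNIV. pmf (q i) g * multiplier G i ?w g j) =
      (1 - ?w) + pmf (q i) j * (b - (1 - ?w))" .
  show ?thesis
  proof (cases "outdeg G i = 1")
    case True
    then have "?w = 1" by (simp add: wager_def)
    moreover from this have "pmf (q i) j = 1"
      using q j True by (simp add: limiting_guess_def)
    ultimately show ?thesis
      unfolding E b_def using True j by (simp add: propagation_matrix_def transition_matrix_def)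
  next
    case False
    then have M: "M $ i $ j = 1 / ?n" using j by (simp add: propagation_matrix_def)
    have b: "b - (1 - ?w) = ?n * ?w" using False by (simp add: b_def algebra_simps)
    show ?thesis
    proof (cases "?w = 0")
      case True
      then show ?thesis
        using wager_0_imp_uniform[OF True \<beta> j] n unfolding E b M by (simp add: field_simps)
    next
      case w: False
      have w_eq: "?w = 1 - ?n * \<beta> * ?m" using False by (simp add: wager_def)
      have "pmf (q i) j = (T $ i $ j - \<beta> * ?m) / ?w"
        using q w False j unfolding w_eq by (simp add: limiting_guess_def w_eq)
      then have "pmf (q i) j * ?w = T $ i $ j - \<beta> * ?m" using w by simp
      moreover have "(1 - ?w) + pmf (q i) j * (?n * ?w) = ?n * (\<beta> * ?m + pmf (q i) j * ?w)"
        using w_eq by (simp add: distrib_left)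
      ultimately have "(1 - ?w) + pmf (q i) j * (?n * ?w) = ?n * T $ i $ j" by simp
      then show ?thesis using n unfolding E b M by simp
    qed
  qed
qed

section \<open>Evolution of the expected fortune\<close>

lemma finite_set_play: "finite (set_pmf (play G p q w i t))"
  by (induction t) auto

lemma expectation_step:
  "measure_pmf.expectation
     (map_pmf (\<lambda>(j, g). (j, f * multiplier G x w g j)) (pair_pmf (chooser_strategy G x) Q))
     (\<lambda>(j, f). f * h j) =
   f * (\<Sum>j\<in>outnbrs G x. T $ x $ j * (\<Sum>g\<in>UNIV. pmf Q g * multiplier G x w g j) * h j)"
  (is "?E = _")
proof -
  have "?E = (\<Sum>(j, g)\<in>UNIV \<times> UNIV. T $ x $ j * pmf Q g * (f * multiplier G x w g j * h j))"
    by (subst integral_map_pmf, subst integral_measure_pmf[of UNIV])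
       (auto simp: case_prod_unfold pmf_pair pmf_chooser_strategy intro!: sum.cong)
  also have "\<dots> = (\<Sum>j\<in>UNIV. f * (T $ x $ j * (\<Sum>g\<in>UNIV. pmf Q g * multiplier G x w g j) * h j))"
    unfolding sum.cartesian_product[symmetric]
    by (simp add: sum_distrib_left sum_distrib_right mult_ac)
  also have "\<dots> = (\<Sum>j\<in>outnbrs G x. f * (T $ x $ j * (\<Sum>g\<in>UNIV. pmf Q g * multiplier G x w g j) * h j))"
    by (rule sum.mono_neutral_right) (auto simp: T_outside)
  finally show ?thesis by (simp add: sum_distrib_left)
qed

text \<open>Averaging out the last step turns the weight for \<open>z\<close> into the weight for
  \<open>M *v z\<close> divided by \<open>r\<^sup>2\<close>: one factor \<open>1 / r\<close> comes
  from the transition probability, the other from the expected multiplier. The weight changes along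
  the way, so the induction is over all \<open>z\<close>.\<close>

lemma expectation_play:
  assumes q: "limiting_guess G \<beta> q" and \<beta>: "0 < \<beta>" "\<beta> \<le> 1"
  shows "measure_pmf.expectation (play G (chooser_strategy G) q (wager G \<beta>) i t)
      (\<lambda>(x, f). f * (z $ x / (u $ x)\<^sup>2)) = ((*v) M ^^ t) z $ i / (r ^ (2 * t) * (u $ i)\<^sup>2)"
proof (induction t arbitrary: z)
  case (Suc t)
  let ?play = "play G (chooser_strategy G) q (wager G \<beta>) i t"
  have step: "(\<Sum>j\<in>outnbrs G x. T $ x $ j *
        (\<Sum>g\<in>UNIV. pmf (q x) g * multiplier G x (wager G \<beta> x) g j) * (z $ j / (u $ j)\<^sup>2)) =
      (M *v z) $ x / (u $ x)\<^sup>2 / r\<^sup>2" for x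
    unfolding M_vec sum_divide_distrib
  proof (rule sum.cong)
    fix j assume j: "j \<in> outnbrs G x"
    let ?e = "\<Sum>g\<in>UNIV. pmf (q x) g * multiplier G x (wager G \<beta> x) g j"
    have "0 < M $ x $ j" using j by (simp add: M_pos_iff)
    moreover have "M $ x $ j * ?e = M $ x $ j * (u $ j / (r * u $ x))"
      using expected_multiplier[OF q \<beta> j] by (simp add: T_eq)
    ultimately have e: "?e = u $ j / (r * u $ x)"
      by (metis mult_left_cancel less_irrefl)
    show "T $ x $ j * ?e * (z $ j / (u $ j)\<^sup>2) = M $ x $ j * z $ j / (u $ x)\<^sup>2 / r\<^sup>2"
      unfolding e T_eq using u_pos[of j] by (simp add: power2_eq_square)
  qed simp
  have "measure_pmf.expectation (play G (chooser_strategy G) q (wager G \<beta>) i (Suc t))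
      (\<lambda>(x, f). f * (z $ x / (u $ x)\<^sup>2)) =
    (\<Sum>a\<in>set_pmf ?play. pmf ?play a *\<^sub>R
      (case a of (x, f) \<Rightarrow> f * ((M *v z) $ x / (u $ x)\<^sup>2 / r\<^sup>2)))"
    unfolding play.simps
  proof (subst pmf_expectation_bind[OF finite_set_play _ subset_refl], goal_cases)
    case 2
    show ?case
      by (rule sum.cong) (auto simp only: split: prod.split simp: expectation_step step)
  qed (auto split: prod.split)
  also have "\<dots> = measure_pmf.expectation ?play (\<lambda>(x, f). f * ((M *v z) $ x / (u $ x)\<^sup>2)) / r\<^sup>2"
    by (subst integral_measure_pmf[OF finite_set_play])
       (auto simp: case_prod_unfold sum_divide_distrib)
  also have "\<dots> = ((*v) M ^^ Suc t) z $ i / (r ^ (2 * Suc t) * (u $ i)\<^sup>2)"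
    unfolding Suc.IH by (simp add: funpow_swap1 power2_eq_square)
  finally show ?case .
qed simp

theorem fortune_limit:
  "\<exists>c>0. \<forall>\<beta> q i. 0 < \<beta> \<and> \<beta> \<le> 1 \<and> limiting_guess G \<beta> q \<longrightarrow>
     (\<lambda>t. r ^ t * expected_fortune G (chooser_strategy G) q (wager G \<beta>) i t)
       \<longlonglongrightarrow> c * limiting_values G $ i"
proof -
  \<comment> \<open>For this \<open>z\<close> the weights in \<open>expectation_play\<close> are all
    1, leaving the expected fortune itself. The constant \<open>c\<close> is obtained before
    \<beta>, \<open>q\<close> and \<open>i\<close> are fixed, so it depends on \<open>G\<close>
    alone.\<close>
  let ?z = "\<chi> i. (u $ i)\<^sup>2"
  obtain c where c: "0 < c" "(\<lambda>s. (1 / r ^ s) *\<^sub>R ((*v) M ^^ s) ?z) \<longlonglongrightarrow> c *\<^sub>R u"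
    using M_pow_limit[of ?z] u_pos by (auto simp: less_imp_neq[symmetric])
  have "(\<lambda>t. r ^ t * expected_fortune G (chooser_strategy G) q (wager G \<beta>) i t)
       \<longlonglongrightarrow> c * limiting_values G $ i"
    if \<beta>: "0 < \<beta>" "\<beta> \<le> 1" and q: "limiting_guess G \<beta> q" for \<beta> q i
  proof -
    have u_nz: "u $ x \<noteq> 0" for x using u_pos[of x] by simp
    have "expected_fortune G (chooser_strategy G) q (wager G \<beta>) i t =
        ((*v) M ^^ t) ?z $ i / (r ^ (2 * t) * (u $ i)\<^sup>2)" for t
      using expectation_play[OF q \<beta>, of i t ?z]
      by (simp add: expected_fortune_def u_nz case_prod_unfold)
    then have "r ^ t * expected_fortune G (chooser_strategy G) q (wager G \<beta>) i t =
        ((1 / r ^ t) *\<^sub>R ((*v) M ^^ t) ?z) $ i / (u $ i)\<^sup>2" for t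
      using r_pos by (simp add: mult_2 power_add)
    moreover have "(\<lambda>t. ((1 / r ^ t) *\<^sub>R ((*v) M ^^ t) ?z) $ i / (u $ i)\<^sup>2)
        \<longlonglongrightarrow> (c *\<^sub>R u) $ i / (u $ i)\<^sup>2"
      by (intro tendsto_intros c(2)) (simp add: u_nz)
    moreover have "(c *\<^sub>R u) $ i / (u $ i)\<^sup>2 = c * limiting_values G $ i"
      by (simp add: limiting_values_def power2_eq_square field_simps u_nz)
    ultimately show ?thesis by simp
  qed
  with c(1) show ?thesis by blast
qed

end

theorem theorem7:
  fixes G :: "'v::finite pair_pre_digraph"
  assumes "pverts G = UNIV"
    and "\<forall>i. 1 \<le> outdeg G i"
    and "strongly_connected (with_proj G)"
    and "aperiodic G"
  shows "transition_matrix G =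
           (1 / max_eigenvalue G) *\<^sub>R
             (diag_matrix (limiting_values G) ** propagation_matrix G **
              matrix_inv (diag_matrix (limiting_values G)))
         \<and> (\<exists>c>0. \<forall>\<beta> q i. 0 < \<beta> \<and> \<beta> \<le> 1 \<and> limiting_guess G \<beta> q \<longrightarrow>
              (\<lambda>t. max_eigenvalue G ^ t *
                    expected_fortune G (chooser_strategy G) q (wager G \<beta>) i t)
                \<longlonglongrightarrow> c * limiting_values G $ i)"
proof -
  interpret aperiodic_game G by unfold_locales (use assms in auto)
  show ?thesis using transition_matrix_eq fortune_limit by blast
qed

end
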